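(* Consider an optimal trajectory of CAV $i$ on which the speed-dependent rear-end safety constraint $p_i(t)+\varphi v_i(t)+\delta_0-p_k^*(t)\le 0$ becomes active (all other state and control constraints being inactive), and let $\tau$ be the junction at which the trajectory passes from an unconstrained arc to the safety-constrained arc $p_i(t)+\varphi v_i(t)+\delta_0-p_k^*(t)=0$. Then the optimal control $u_i^*(t)$ is continuous at $\tau$, i.e. $u_i^*(\tau^-)=u_i^*(\tau^+)$.
   Context: Problem. CAV $i$ travels a distance $L+S$ (a control zone of length $L$ followed by a merging zone of length $S$) with dynamics $\dot p_i=v_i$, $\dot v_i=u_i$, $p_i(t_i^0)=0$, $v_i(t_i^0)=v_i^0$ given, $p_i(t_i^f)=L+S$, and minimizes $\int_{t_i^0}^{t_i^f}\big[\gamma+\tfrac12u_i^2(t)\big]dt$, where $\gamma\ge 0$ is a constant weight (the terminal time $t_i^f$ may be free or constrained). The constraints are $u_{\min}\le u_i(t)\le u_{\max}$, $0\le v_{\min}\le v_i(t)\le v_{\max}$, and the rear-end safety constraint $p_k^*(t)-p_i(t)\ge\varphi v_i(t)+\delta_0$ on $[t_i^0,t_i^f]$, with $\varphi>0$ and $\delta_0\ge0$ constants (together with bounds on $t_i^f$ and a lateral collision constraint $p_i(t_1)\le L$ at a given time $t_1$, which are not active here). Here $k<i$ is the CAV physically ahead of $i$ on the same lane. Its optimal trajectory is a known function of time: $u_k^*(t)=a_kt+b_k$, $v_k^*=\dot p_k^*$, $u_k^*=\dot v_k^*$ on $[t_k^0,t_k^f]$ (so $p_k^*$ is a cubic polynomial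 there), and CAV $k$ travels at constant speed $v_k^*(t_k^f)$ for $t\in(t_k^f,t_i^f]$; $u_k^*$ is continuous. The safety constraint is not active at $t_i^0$. Necessary conditions satisfied by an optimal trajectory. The Hamiltonian is $H_i=\gamma+\tfrac12u_i^2+\lambda_i^pv_i+\lambda_i^vu_i$, with costates $\lambda_i^p,\lambda_i^v$. The states $p_i,v_i$ are continuous, and the control and costates have one-sided limits at $\tau$. - On an unconstrained arc (no constraint active): $\dot\lambda_i^p=0$, $\dot\lambda_i^v=-\lambda_i^p$, and $u_i^*(t)=-\lambda_i^v(t)$. - On the safety-constrained arc: $p_i(t)+\varphi v_i(t)+\delta_0-p_k^*(t)=0$ and, differentiating, $v_i(t)+\varphi u_i(t)-v_k^*(t)=0$. - At the entry time $\tau$ of the safety-constrained arc, with $N_i(p_i,v_i,t)=p_i+\varphi v_i+\delta_0-p_k^*(t)$, there is a constant multiplier $\pi_i\ge0$ such that $$\lambda_i^p(\tau^-)=\lambda_i^p(\tau^+)+\pi_i\frac{\partial N_i}{\partial p_i},\quad \lambda_i^v(\tau^-)=\lambda_i^v(\tau^+)+\pi_i\frac{\partial N_i}{\partial v_i},\quad H_i(\tau^-)=H_i(\tau^+)-\pi_i\frac{\partial N_i}{\partial t},$$ where $\tau^-$ and $\tau^+$ denote left and right limits. *)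

theory Defs
  imports "HOL-Analysis.Analysis"
begin

text \<open>
  Data of the problem of one vehicle (CAV \<open>i\<close>), including the known trajectory of the vehicle
  ahead of it (CAV \<open>k\<close>). The terminal time is restricted to \<open>tf_target\<close> (\<open>UNIV\<close> if it is free, a
  smaller set, e.g. a singleton, if it is constrained) and by bounds \<open>tf_lb\<close>, \<open>tf_ub\<close>, which are
  infinite if absent.
\<close>

record cav_problem =
  weight :: real            \<comment> \<open>\<open>\<gamma>\<close>\<close>
  cz_length :: real         \<comment> \<open>\<open>L\<close>\<close>
  mz_length :: real         \<comment> \<open>\<open>S\<close>\<close>
  t0 :: real
  v0 :: real
  u_min :: real
  u_max :: real
  v_min :: real
  v_max :: real
  headway :: real           \<comment> \<open>\<open>\<phi>\<close>\<close>
  standstill :: real        \<comment> \<open>\<open>\<delta>\<^sub>0\<close>\<close>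
  tf_target :: "real set"
  tf_lb :: ereal
  tf_ub :: ereal
  t_lat :: real             \<comment> \<open>\<open>t\<^sub>1\<close>, the time of the lateral constraint\<close>
  tk0 :: real
  tkf :: real
  slope_k :: real           \<comment> \<open>\<open>a\<^sub>k\<close>\<close>
  offset_k :: real          \<comment> \<open>\<open>b\<^sub>k\<close>\<close>
  pos_k :: "real \<Rightarrow> real"
  vel_k :: "real \<Rightarrow> real"
  ctrl_k :: "real \<Rightarrow> real"

record trajectory =
  pos :: "real \<Rightarrow> real"
  vel :: "real \<Rightarrow> real"
  ctrl :: "real \<Rightarrow> real"
  tf :: real

text \<open>
  CAV \<open>k\<close> is described on all of \<open>[tk0, \<infinity>)\<close>, since the trajectories with which an optimal one is
  compared may have any terminal time. Continuity of its control across \<open>tkf\<close>, where the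
  constant-speed motion starts, amounts to \<open>slope_k * tkf + offset_k = 0\<close>.
\<close>

definition preceding_vehicle :: "cav_problem \<Rightarrow> bool" where
  "preceding_vehicle P \<longleftrightarrow>
     tk0 P < tkf P \<and> tk0 P \<le> t0 P \<and>
     (\<forall>t\<ge>tk0 P. (pos_k P has_real_derivative vel_k P t) (at t within {tk0 P..})) \<and>
     (\<forall>t\<ge>tk0 P. (vel_k P has_real_derivative ctrl_k P t) (at t within {tk0 P..})) \<and>
     (\<forall>t\<in>{tk0 P..tkf P}. ctrl_k P t = slope_k P * t + offset_k P) \<and>
     (\<forall>t>tkf P. vel_k P t = vel_k P (tkf P)) \<and>
     continuous_on {tk0 P..} (ctrl_k P)"

definition safety_fn :: "cav_problem \<Rightarrow> real \<Rightarrow> real \<Rightarrow> real \<Rightarrow> real" where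
  "safety_fn P p v t = p + headway P * v + standstill P - pos_k P t"

definition problem_data :: "cav_problem \<Rightarrow> bool" where
  "problem_data P \<longleftrightarrow>
     weight P \<ge> 0 \<and> cz_length P > 0 \<and> mz_length P > 0 \<and> 0 \<le> v_min P \<and>
     headway P > 0 \<and> standstill P \<ge> 0 \<and>
     preceding_vehicle P \<and>
     safety_fn P 0 (v0 P) (t0 P) < 0"

text \<open>Admissible controls are piecewise continuous.\<close>

definition dynamics :: "cav_problem \<Rightarrow> trajectory \<Rightarrow> bool" where
  "dynamics P x \<longleftrightarrow>
     (let I = {t0 P..tf x} in
       (\<forall>t\<in>I. (pos x has_real_derivative vel x t) (at t within I)) \<and>
       continuous_on I (vel x) \<and>
       (\<exists>D. finite D \<and> continuous_on (I - D) (ctrl x) \<and>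
            (\<forall>t\<in>I - D. (vel x has_real_derivative ctrl x t) (at t within I))))"

text \<open>
  The lateral constraint is void if \<open>t_lat\<close> precedes the initial time; otherwise the vehicle must
  still be under way at time \<open>t_lat\<close>.
\<close>

definition feasible :: "cav_problem \<Rightarrow> trajectory \<Rightarrow> bool" where
  "feasible P x \<longleftrightarrow>
     t0 P < tf x \<and> tf x \<in> tf_target P \<and> tf_lb P \<le> ereal (tf x) \<and> ereal (tf x) \<le> tf_ub P \<and>
     dynamics P x \<and>
     pos x (t0 P) = 0 \<and> vel x (t0 P) = v0 P \<and> pos x (tf x) = cz_length P + mz_length P \<and>
     (\<forall>t\<in>{t0 P..tf x}.
        u_min P \<le> ctrl x t \<and> ctrl x t \<le> u_max P \<and>
        v_min P \<le> vel x t \<and> vel x t \<le> v_max P \<and>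
        safety_fn P (pos x t) (vel x t) t \<le> 0) \<and>
     (t0 P \<le> t_lat P \<longrightarrow> t_lat P \<le> tf x \<and> pos x (t_lat P) \<le> cz_length P)"

definition cost :: "cav_problem \<Rightarrow> trajectory \<Rightarrow> real" where
  "cost P x = integral {t0 P..tf x} (\<lambda>t. weight P + (ctrl x t)\<^sup>2 / 2)"

definition optimal :: "cav_problem \<Rightarrow> trajectory \<Rightarrow> bool" where
  "optimal P x \<longleftrightarrow> feasible P x \<and> (\<forall>y. feasible P y \<longrightarrow> cost P x \<le> cost P y)"

definition others_inactive :: "cav_problem \<Rightarrow> trajectory \<Rightarrow> bool" where
  "others_inactive P x \<longleftrightarrow>
     (\<forall>t\<in>{t0 P..tf x}.
        u_min P < ctrl x t \<and> ctrl x t < u_max P \<and> v_min P < vel x t \<and> vel x t < v_max P) \<and>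
     tf_lb P < ereal (tf x) \<and> ereal (tf x) < tf_ub P \<and>
     (t0 P \<le> t_lat P \<longrightarrow> pos x (t_lat P) < cz_length P)"

definition safety_entry :: "cav_problem \<Rightarrow> trajectory \<Rightarrow> real \<Rightarrow> real \<Rightarrow> real \<Rightarrow> bool" where
  "safety_entry P x s \<tau> e \<longleftrightarrow>
     t0 P \<le> s \<and> s < \<tau> \<and> \<tau> < e \<and> e \<le> tf x \<and>
     (\<forall>t\<in>{s<..<\<tau>}. safety_fn P (pos x t) (vel x t) t < 0) \<and>
     (\<forall>t\<in>{\<tau>..e}. safety_fn P (pos x t) (vel x t) t = 0)"

definition has_one_sided_limits :: "(real \<Rightarrow> real) \<Rightarrow> real \<Rightarrow> bool" where
  "has_one_sided_limits f \<tau> \<longleftrightarrow>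
     (\<exists>l. (f \<longlongrightarrow> l) (at_left \<tau>)) \<and> (\<exists>r. (f \<longlongrightarrow> r) (at_right \<tau>))"

definition left_lim :: "(real \<Rightarrow> real) \<Rightarrow> real \<Rightarrow> real" where
  "left_lim f \<tau> = Lim (at_left \<tau>) f"

definition right_lim :: "(real \<Rightarrow> real) \<Rightarrow> real \<Rightarrow> real" where
  "right_lim f \<tau> = Lim (at_right \<tau>) f"

definition hamiltonian ::
    "cav_problem \<Rightarrow> trajectory \<Rightarrow> (real \<Rightarrow> real) \<Rightarrow> (real \<Rightarrow> real) \<Rightarrow> real \<Rightarrow> real" where
  "hamiltonian P x lp lv t =
     weight P + (ctrl x t)\<^sup>2 / 2 + lp t * vel x t + lv t * ctrl x t"

definition unconstrained_arc_conditions ::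
    "trajectory \<Rightarrow> (real \<Rightarrow> real) \<Rightarrow> (real \<Rightarrow> real) \<Rightarrow> real \<Rightarrow> real \<Rightarrow> bool" where
  "unconstrained_arc_conditions x lp lv a b \<longleftrightarrow>
     (\<forall>t\<in>{a<..<b}.
        (lp has_real_derivative 0) (at t) \<and>
        (lv has_real_derivative - lp t) (at t) \<and>
        ctrl x t = - lv t)"

definition entry_conditions ::
    "cav_problem \<Rightarrow> trajectory \<Rightarrow> (real \<Rightarrow> real) \<Rightarrow> (real \<Rightarrow> real) \<Rightarrow> real \<Rightarrow> bool" where
  "entry_conditions P x lp lv \<tau> \<longleftrightarrow>
     has_one_sided_limits (ctrl x) \<tau> \<and>
     has_one_sided_limits lp \<tau> \<and>
     has_one_sided_limits lv \<tau> \<and>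
     (\<exists>\<pi>\<ge>0.
        left_lim lp \<tau> = right_lim lp \<tau> + \<pi> * deriv (\<lambda>p. safety_fn P p (vel x \<tau>) \<tau>) (pos x \<tau>) \<and>
        left_lim lv \<tau> = right_lim lv \<tau> + \<pi> * deriv (\<lambda>v. safety_fn P (pos x \<tau>) v \<tau>) (vel x \<tau>) \<and>
        left_lim (hamiltonian P x lp lv) \<tau> =
          right_lim (hamiltonian P x lp lv) \<tau>
          - \<pi> * deriv (\<lambda>t. safety_fn P (pos x \<tau>) (vel x \<tau>) t) \<tau>)"

end

theory Submission
  imports Defs
begin

text \<open>
  The jump conditions make the squared jump of the control a multiple of the rate at which the
  safety function changes on the constrained arc, and that rate is zero. Write \<open>u\<^sub>-\<close>, \<open>u\<^sub>+\<close>
  for the one-sided limits of the control at \<open>\<tau>\<close> and \<open>\<pi>\<close> for the multiplier. Before \<open>\<tau>\<close> the control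
  is the stationary point \<open>- \<lambda>\<^sup>v\<close> of the Hamiltonian, so \<open>\<lambda>\<^sup>v(\<tau>\<^sup>-) = - u\<^sub>-\<close>; the costate jumps then express
  \<open>\<lambda>\<^sup>p(\<tau>\<^sup>+)\<close> and \<open>\<lambda>\<^sup>v(\<tau>\<^sup>+)\<close> through quantities on the left. Substituted into the jump of the
  Hamiltonian, and with continuity of the speed, they give
  \<open>(u\<^sub>- - u\<^sub>+)\<^sup>2 / 2 = \<pi> (v\<^sub>i(\<tau>) + \<phi> u\<^sub>+ - v\<^sub>k(\<tau>))\<close>.
  The right-hand factor is the total time derivative of the safety function along the trajectory,
  taken at \<open>\<tau>\<^sup>+\<close>. It vanishes because the safety function is identically zero after \<open>\<tau>\<close>
  (\<open>constrained_arc_control_limit\<close>), and then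
  so does the square (\<open>control_jump_zero\<close>).
\<close>

text \<open>
  Eliminating \<open>lp'\<close> and \<open>lv'\<close> (the costates after the jump) leaves
  \<open>(u - u')\<^sup>2 / 2 = m * (v + h * u' - w)\<close>, whose right-hand side is zero by tangency.
\<close>

lemma control_jump_zero:
  fixes u u' v w lp lp' lv lv' g h m :: real
  assumes stationary: "u = - lv"
    and tangent: "v + h * u' - w = 0"
    and jump_p: "lp = lp' + m"
    and jump_v: "lv = lv' + m * h"
    and jump_H: "g + u\<^sup>2 / 2 + lp * v + lv * u = g + u'\<^sup>2 / 2 + lp' * v + lv' * u' + m * w"
  shows "u = u'"
proof -
  have lv': "lv' = - u - m * h" and lp': "lp' = lp - m"
    using stationary jump_p jump_v by auto
  have "(u - u')\<^sup>2 / 2 = m * (v + h * u' - w)"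
    using jump_H stationary unfolding lv' lp'
    by (simp add: power2_eq_square field_simps)
  then show ?thesis
    using tangent by simp
qed

lemma left_lim_eq: "(f \<longlongrightarrow> l) (at_left \<tau>) \<Longrightarrow> left_lim f \<tau> = l"
  unfolding left_lim_def by (rule tendsto_Lim) auto

lemma right_lim_eq: "(f \<longlongrightarrow> r) (at_right \<tau>) \<Longrightarrow> right_lim f \<tau> = r"
  unfolding right_lim_def by (rule tendsto_Lim) auto

lemma tendsto_hamiltonian:
  assumes "(ctrl x \<longlongrightarrow> u) F" "(vel x \<longlongrightarrow> v) F" "(lp \<longlongrightarrow> p) F" "(lv \<longlongrightarrow> q) F"
  shows "(hamiltonian P x lp lv \<longlongrightarrow> weight P + u\<^sup>2 / 2 + p * v + q * u) F"
  unfolding hamiltonian_def[abs_def] by (intro tendsto_intros assms) auto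

lemma preceding_vehicle_at:
  assumes "preceding_vehicle P" "tk0 P < t"
  shows "(pos_k P has_real_derivative vel_k P t) (at t)"
    and "isCont (vel_k P) t"
proof -
  have "at t within {tk0 P..} = at t"
    using assms(2) by (intro at_within_interior) (simp add: interior_real_atLeast)
  moreover have "tk0 P \<le> t"
    using assms(2) by simp
  ultimately show "(pos_k P has_real_derivative vel_k P t) (at t)"
      and "isCont (vel_k P) t"
    using assms(1) unfolding preceding_vehicle_def by (metis DERIV_isCont)+
qed

lemma dynamics_isCont_vel:
  assumes "dynamics P x" "t0 P < t" "t < tf x"
  shows "isCont (vel x) t"
proof -
  have "continuous_on {t0 P..tf x} (vel x)"
    using assms(1) by (simp add: dynamics_def Let_def)
  then show ?thesis
    using assms(2,3) by (simp add: continuous_on_interior)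
qed

text \<open>
  The safety function vanishes on a whole interval to the right of \<open>\<tau>\<close>, hence so does its derivative
  \<open>v\<^sub>i + \<phi> u\<^sub>i - v\<^sub>k\<close> wherever the control is the derivative of the speed. The finitely many
  exceptional times do not accumulate at \<open>\<tau>\<close>, so the identity passes to the right limit.
\<close>

lemma constrained_arc_control_limit:
  assumes pk: "preceding_vehicle P" and dyn: "dynamics P x"
    and bounds: "t0 P < \<tau>" "\<tau> < e" "e \<le> tf x"
    and active: "\<And>t. t \<in> {\<tau>..e} \<Longrightarrow> safety_fn P (pos x t) (vel x t) t = 0"
    and lim: "(ctrl x \<longlongrightarrow> u) (at_right \<tau>)"
  shows "vel x \<tau> + headway P * u - vel_k P \<tau> = 0"
proof -
  let ?I = "{t0 P..tf x}"
  let ?f = "\<lambda>t. vel x t + headway P * ctrl x t - vel_k P t"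
  have tk: "tk0 P \<le> t0 P"
    using pk by (simp add: preceding_vehicle_def)
  obtain D where D: "finite D"
      and pos': "\<And>t. t \<in> ?I \<Longrightarrow> (pos x has_real_derivative vel x t) (at t within ?I)"
      and vel': "\<And>t. t \<in> ?I - D \<Longrightarrow> (vel x has_real_derivative ctrl x t) (at t within ?I)"
    using dyn unfolding dynamics_def Let_def by blast
  have zero: "?f t = 0" if t: "t \<in> {\<tau><..<e}" "t \<notin> D" for t
  proof -
    have tI: "t \<in> ?I" and "at t within ?I = at t"
      using t bounds by (auto intro!: at_within_interior)
    then have d: "(pos x has_real_derivative vel x t) (at t)"
        "(vel x has_real_derivative ctrl x t) (at t)"
      using pos'[of t] vel'[of t] t by auto
    have dk: "(pos_k P has_real_derivative vel_k P t) (at t)"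
      using t bounds tk by (intro preceding_vehicle_at pk) auto
    have "((\<lambda>t. safety_fn P (pos x t) (vel x t) t) has_real_derivative ?f t) (at t)"
      unfolding safety_fn_def by (rule derivative_eq_intros d dk refl | simp)+
    moreover have "((\<lambda>t. safety_fn P (pos x t) (vel x t) t) has_real_derivative 0) (at t)"
      by (rule has_field_derivative_transform_within_open[of "\<lambda>_. 0" _ _ "{\<tau><..<e}"])
        (use t active in auto)
    ultimately show ?thesis
      by (rule DERIV_unique)
  qed
  have "eventually (\<lambda>t. t \<notin> D) (at_right \<tau>)"
    using islimpt_finite[OF D, of \<tau>] by (simp add: islimpt_iff_eventually eventually_at_split)
  moreover have "eventually (\<lambda>t. t \<in> {\<tau><..<e}) (at_right \<tau>)"
    using bounds by (intro eventually_at_right_real) auto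
  ultimately have "eventually (\<lambda>t. ?f t = 0) (at_right \<tau>)"
    by eventually_elim (rule zero)
  then have "(?f \<longlongrightarrow> 0) (at_right \<tau>)"
    by (rule tendsto_eventually)
  moreover have "isCont (vel x) \<tau>" "isCont (vel_k P) \<tau>"
    using bounds tk by (auto intro: dynamics_isCont_vel[OF dyn] preceding_vehicle_at(2)[OF pk])
  then have "(?f \<longlongrightarrow> vel x \<tau> + headway P * u - vel_k P \<tau>) (at_right \<tau>)"
    by (intro tendsto_intros lim) (auto simp: isCont_def filterlim_at_split)
  ultimately show ?thesis
    using tendsto_unique[OF trivial_limit_at_right_real] by metis
qed

lemma deriv_safety_fn_position: "deriv (\<lambda>p. safety_fn P p v t) p = 1"
  unfolding safety_fn_def by (rule DERIV_imp_deriv) (auto intro!: derivative_eq_intros)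

lemma deriv_safety_fn_speed: "deriv (\<lambda>v. safety_fn P p v t) v = headway P"
  unfolding safety_fn_def by (rule DERIV_imp_deriv) (auto intro!: derivative_eq_intros)

lemma deriv_safety_fn_time:
  assumes "preceding_vehicle P" "tk0 P < t"
  shows "deriv (\<lambda>t. safety_fn P p v t) t = - vel_k P t"
  unfolding safety_fn_def
  by (rule DERIV_imp_deriv)
    (auto intro!: derivative_eq_intros preceding_vehicle_at[OF assms])

theorem theorem2:
  fixes P :: cav_problem and x :: trajectory
    and lp lv :: "real \<Rightarrow> real" and s \<tau> e :: real
  assumes "problem_data P"
    and "optimal P x"
    and "others_inactive P x"
    and "safety_entry P x s \<tau> e"
    and "unconstrained_arc_conditions x lp lv s \<tau>"
    and "entry_conditions P x lp lv \<tau>"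
  shows "left_lim (ctrl x) \<tau> = right_lim (ctrl x) \<tau>"
proof -
  have pk: "preceding_vehicle P" and dyn: "dynamics P x"
    using assms(1,2) by (auto simp: problem_data_def optimal_def feasible_def)
  have bounds: "t0 P \<le> s" "s < \<tau>" "\<tau> < e" "e \<le> tf x"
      and active: "\<And>t. t \<in> {\<tau>..e} \<Longrightarrow> safety_fn P (pos x t) (vel x t) t = 0"
    using assms(4) by (auto simp: safety_entry_def)
  have tk: "tk0 P < \<tau>"
    using pk bounds by (simp add: preceding_vehicle_def)
  obtain ul ur pl pr ql qr where
      lim: "(ctrl x \<longlongrightarrow> ul) (at_left \<tau>)" "(ctrl x \<longlongrightarrow> ur) (at_right \<tau>)"
        "(lp \<longlongrightarrow> pl) (at_left \<tau>)" "(lp \<longlongrightarrow> pr) (at_right \<tau>)"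
        "(lv \<longlongrightarrow> ql) (at_left \<tau>)" "(lv \<longlongrightarrow> qr) (at_right \<tau>)"
    using assms(6) unfolding entry_conditions_def has_one_sided_limits_def by blast
  have "isCont (vel x) \<tau>"
    using bounds by (intro dynamics_isCont_vel[OF dyn]) auto
  then have vel: "(vel x \<longlongrightarrow> vel x \<tau>) (at_left \<tau>)" "(vel x \<longlongrightarrow> vel x \<tau>) (at_right \<tau>)"
    by (auto simp: isCont_def filterlim_at_split)
  note lims = left_lim_eq[OF lim(1)] right_lim_eq[OF lim(2)] left_lim_eq[OF lim(3)]
    right_lim_eq[OF lim(4)] left_lim_eq[OF lim(5)] right_lim_eq[OF lim(6)]
    left_lim_eq[OF tendsto_hamiltonian[OF lim(1) vel(1) lim(3,5)]]
    right_lim_eq[OF tendsto_hamiltonian[OF lim(2) vel(2) lim(4,6)]]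
  obtain m where jumps: "pl = pr + m" "ql = qr + m * headway P"
      "weight P + ul\<^sup>2 / 2 + pl * vel x \<tau> + ql * ul
        = weight P + ur\<^sup>2 / 2 + pr * vel x \<tau> + qr * ur + m * vel_k P \<tau>"
    using assms(6) unfolding entry_conditions_def lims deriv_safety_fn_position
      deriv_safety_fn_speed deriv_safety_fn_time[OF pk tk] by auto
  have "eventually (\<lambda>t. t \<in> {s<..<\<tau>}) (at_left \<tau>)"
    using bounds by (intro eventually_at_left_real) auto
  then have "eventually (\<lambda>t. - lv t = ctrl x t) (at_left \<tau>)"
    by eventually_elim (use assms(5) in \<open>simp add: unconstrained_arc_conditions_def\<close>)
  then have "(ctrl x \<longlongrightarrow> - ql) (at_left \<tau>)"
    using tendsto_minus[OF lim(5)] by (rule Lim_transform_eventually[rotated])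
  then have "ul = - ql"
    using lim(1) by (metis left_lim_eq)
  moreover have "vel x \<tau> + headway P * ur - vel_k P \<tau> = 0"
    using bounds by (intro constrained_arc_control_limit[OF pk dyn _ bounds(3,4) active lim(2)]) auto
  ultimately have "ul = ur"
    using jumps by (rule control_jump_zero)
  then show ?thesis
    by (simp add: lims)
qed

end
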